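(* Let $l\ge 2$ be an integer and let $q=p^e$ be a power of a prime $p\notin\{2,3\}$ with $q\equiv 1\pmod l$. Let $S$ be a multiplicative character on $\mathbb{F}_q$ of order $l$ and, when $q\equiv1\pmod 3$, let $\chi_3$ be a multiplicative character on $\mathbb{F}_q$ of order $3$. Then for $\lambda=\frac13$: $$-a_q(C_{l,\lambda})=\begin{cases}0, & \text{if } l\ne 3 \text{ and } q\equiv 2\pmod 3;\\[2mm] q\displaystyle\sum_{i=1}^{l-1}S^i\!\left(\tfrac{27}{8}\right)\left[\binom{\chi_3}{S^i}+\binom{\chi_3^2}{S^i}\right], & \text{if } l\neq 3\text{ and } q\equiv 1\pmod 3;\\[2mm] 2+q\displaystyle\sum_{i=1}^{2}\left[\binom{\chi_3}{\chi_3^i}+\binom{\chi_3^2}{\chi_3^i}\right], & \text{if } l=3.\end{cases}$$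
   Context: Multiplicative characters on $\mathbb{F}_q^\times$ are complex valued and are all (including the trivial one) extended to $\mathbb{F}_q$ by $\chi(0):=0$; $\overline{B}$ is the inverse of $B$. The binomial coefficient is $\binom{A}{B}:=\frac{B(-1)}{q}\sum_{x\in\mathbb{F}_q}A(x)\overline{B}(1-x)$. Rational numbers with denominator prime to $p$ are regarded as elements of $\mathbb{F}_q$ by reduction mod $p$. $C_{l,\lambda}$ is the nonsingular projective algebraic curve over $\mathbb{Q}$ with affine equation $y^l=(x-1)(x^2+\lambda)$. For a prime $p$ of good reduction and $q=p^e$, $a_q(C_{l,\lambda}):=1+q-\#C_{l,\lambda}(\mathbb{F}_q)$. The number of points $\#C_{l,\lambda}(\mathbb{F}_q)$ is taken as follows: with $N=\#\{(x,y)\in\mathbb{F}_q^2: y^l=(x-1)(x^2+\lambda)\}$, $\#C_{l,\lambda}(\mathbb{F}_q)=1+N$ for every $l\neq 3$, and $\#C_{3,\lambda}(\mathbb{F}_q)=3+N$ for $l=3$ and $q\equiv 1\pmod 3$. A prime $p\nmid l$ is of good reduction iff $\mathrm{ord}_p(\lambda(\lambda+1))=0$. *)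

theory Defs
  imports Complex_Main "HOL-Library.Cardinality" "HOL-Number_Theory.Cong"
begin

text \<open>
  The finite field of order \<open>q\<close> is a type \<open>'a\<close> of class \<open>field\<close> and \<open>finite\<close> with
  \<open>CARD('a) = q\<close>.
\<close>

text \<open>
  Reduction of a rational number into a finite field, meaningful if the characteristic does not
  divide the denominator (\<open>of_rat\<close> is only available in characteristic 0).
\<close>

definition rat_red :: "rat \<Rightarrow> 'a :: field" where
  "rat_red r = of_int (fst (quotient_of r)) / of_int (snd (quotient_of r))"

definition mult_char :: "('a :: field \<Rightarrow> complex) \<Rightarrow> bool" where
  "mult_char \<chi> \<longleftrightarrow>
     \<chi> 0 = 0 \<and> (\<forall>x. x \<noteq> 0 \<longrightarrow> \<chi> x \<noteq> 0) \<and> (\<forall>x y. \<chi> (x * y) = \<chi> x * \<chi> y)"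

definition triv_char :: "'a :: field \<Rightarrow> complex" where
  "triv_char x = (if x = 0 then 0 else 1)"

text \<open>The case distinction makes the 0-th power the trivial character, also at 0.\<close>

definition char_pow :: "('a :: field \<Rightarrow> complex) \<Rightarrow> nat \<Rightarrow> 'a \<Rightarrow> complex" where
  "char_pow \<chi> n x = (if x = 0 then 0 else \<chi> x ^ n)"

text \<open>This maps 0 to 0 since \<open>inverse 0 = 0\<close>.\<close>

definition char_inv :: "('a :: field \<Rightarrow> complex) \<Rightarrow> 'a \<Rightarrow> complex" where
  "char_inv \<chi> x = inverse (\<chi> x)"

definition char_order :: "('a :: field \<Rightarrow> complex) \<Rightarrow> nat" where
  "char_order \<chi> = (LEAST n. n > 0 \<and> char_pow \<chi> n = triv_char)"

definition char_binom ::
    "('a :: {field, finite} \<Rightarrow> complex) \<Rightarrow> ('a \<Rightarrow> complex) \<Rightarrow> complex" where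
  "char_binom A B = B (- 1) / of_nat CARD('a) * (\<Sum>x\<in>UNIV. A x * char_inv B (1 - x))"

definition affine_points :: "nat \<Rightarrow> rat \<Rightarrow> ('a :: {field, finite} \<times> 'a) set" where
  "affine_points l lam = {(x, y). y ^ l = (x - 1) * (x\<^sup>2 + rat_red lam)}"

text \<open>
  The number of points over \<open>'a\<close> of the projective curve with affine equation
  \<open>y^l = (x - 1) * (x^2 + lam)\<close>.  By convention, exactly one point at infinity is counted for
  every \<open>l \<noteq> 3\<close>, even if 3 divides \<open>l\<close>; for \<open>l = 3\<close> there are three of them if
  \<open>CARD('a)\<close> is 1 modulo 3 (and just one rational over \<open>'a\<close> if it is 2 modulo 3).
\<close>

definition curve_points :: "'a :: {field, finite} itself \<Rightarrow> nat \<Rightarrow> rat \<Rightarrow> nat" where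
  "curve_points _ l lam =
     (if l = 3 \<and> [CARD('a) = 1] (mod 3) then 3 else 1)
       + card (affine_points l lam :: ('a \<times> 'a) set)"

definition curve_trace :: "'a :: {field, finite} itself \<Rightarrow> nat \<Rightarrow> rat \<Rightarrow> int" where
  "curve_trace F l lam = 1 + int CARD('a) - int (curve_points F l lam)"

end

(*
  For lam = 1/3 the cubic (x - 1) (x^2 + lam) equals (x - 1/3)^3 - (2/3)^3, so the affine curve
  is isomorphic to y^l = u^3 - c with c = 8/27.  If q is 2 modulo 3, cubing permutes the field and
  there are exactly q affine points.  If q is 1 modulo 3, both y^l and u^3 are counted with
  characters of order l and 3, which turns the number of points into sums of the form
  \<Sum>w. \<chi>\<^sub>3(w) S^j(w - c); rescaling w by the cube c makes them Jacobi sums.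
*)

theory Submission
  imports Defs "HOL-Computational_Algebra.Polynomial"
begin

section \<open>Finite fields\<close>

text \<open>Multiplication by \<open>x\<close> permutes the nonzero elements, so their product,
  itself nonzero, absorbs the factor \<open>x ^ (CARD('a) - 1)\<close>.\<close>

lemma power_card_minus_one_eq_one:
  fixes x :: "'a :: {field, finite}"
  assumes "x \<noteq> 0"
  shows "x ^ (CARD('a) - 1) = 1"
proof -
  have "(\<Prod>y\<in>UNIV-{0}. x * y) = (\<Prod>y\<in>UNIV-{0}. y)"
    by (rule prod.reindex_bij_witness[of _ "\<lambda>y. y / x" "\<lambda>y. x * y"]) (use assms in auto)
  then have "x ^ (CARD('a) - 1) * \<Prod>(UNIV-{0}) = 1 * \<Prod>(UNIV-{0::'a})"
    by (simp add: prod.distrib)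
  then show ?thesis
    by simp
qed

text \<open>Serves to make 2 and 3 invertible. Translation by 1 permutes the field, so summing all
  elements gives \<open>of_nat CARD('a) = 0\<close>; hence the characteristic divides
  \<open>p ^ e\<close>.\<close>

lemma of_nat_prime_eq_0_imp_eq:
  assumes "prime p" "CARD('a :: {field, finite}) = p ^ e" "prime r" "of_nat r = (0 :: 'a)"
  shows "r = p"
proof -
  have "prime CHAR('a)"
    by (rule prime_CHAR_semidom) (simp add: finite_imp_CHAR_pos)
  moreover have "CHAR('a) dvd p ^ e"
  proof -
    have "(\<Sum>x\<in>UNIV. x + 1 :: 'a) = (\<Sum>x\<in>UNIV. x)"
      by (rule sum.reindex_bij_witness[of _ "\<lambda>x. x - 1" "\<lambda>x. x + 1"]) auto
    then have "of_nat CARD('a) = (0 :: 'a)"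
      by (simp add: sum.distrib)
    then show ?thesis
      using assms(2) by (simp only: of_nat_eq_0_iff_char_dvd)
  qed
  moreover have "CHAR('a) dvd r"
    using assms(4) by (simp add: of_nat_eq_0_iff_char_dvd)
  ultimately show ?thesis
    by (metis assms(1,3) prime_dvd_power primes_dvd_imp_eq)
qed

text \<open>If \<open>CARD('a) - 1 = 3 * k + 1\<close>, then \<open>x * (x ^ 3) ^ k = 1\<close> for
  nonzero \<open>x\<close>, so \<open>x\<close> can be recovered from its cube.\<close>

lemma bij_cube:
  assumes "[CARD('a :: {field, finite}) = 2] (mod 3)"
  shows "bij (\<lambda>x :: 'a. x ^ 3)"
proof -
  define k where "k = CARD('a) div 3"
  have k: "CARD('a) - 1 = 3 * k + 1"
    using assms unfolding cong_def k_def by presburger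
  have "x = inverse ((x ^ 3) ^ k)" if "x \<noteq> 0" for x :: 'a
  proof -
    have "x * (x ^ 3) ^ k = 1"
      using power_card_minus_one_eq_one[OF that] k by (simp add: power_mult)
    then show ?thesis
      by (metis inverse_inverse_eq inverse_unique mult.commute)
  qed
  then have "inj (\<lambda>x :: 'a. x ^ 3)"
    by (intro injI) (metis power_eq_0_iff power_zero_numeral)
  then show ?thesis
    by (simp add: bij_def finite_UNIV_inj_surj)
qed

text \<open>The solutions are the roots of \<open>X^n - z\<close>, a nonzero polynomial because
  \<open>n > 0\<close>.\<close>

lemma card_power_eq_le:
  fixes z :: "'a :: idom"
  assumes "n > 0"
  shows "card {y. y ^ n = z} \<le> n"
proof -
  define P where "P = monom 1 n - [:z:]"
  have "coeff P n = 1"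
    using assms by (simp add: P_def coeff_pCons split: nat.splits)
  then have "P \<noteq> 0"
    by auto
  moreover have "degree P \<le> n"
    unfolding P_def by (intro degree_diff_le) (auto simp: degree_monom_eq)
  moreover have "{y. poly P y = 0} = {y. y ^ n = z}"
    by (auto simp: P_def poly_monom)
  ultimately show ?thesis
    using card_poly_roots_bound[of P] by simp
qed

section \<open>Multiplicative characters\<close>

lemma mult_char_zero: "mult_char \<chi> \<Longrightarrow> \<chi> 0 = 0"
  and mult_char_nonzero: "mult_char \<chi> \<Longrightarrow> x \<noteq> 0 \<Longrightarrow> \<chi> x \<noteq> 0"
  and mult_char_mult: "mult_char \<chi> \<Longrightarrow> \<chi> (x * y) = \<chi> x * \<chi> y"
  by (auto simp: mult_char_def)

lemma mult_char_one: "mult_char \<chi> \<Longrightarrow> \<chi> 1 = 1"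
  using mult_char_mult[of \<chi> 1 1] mult_char_nonzero[of \<chi> 1] by simp

lemma mult_char_power: "mult_char \<chi> \<Longrightarrow> \<chi> (x ^ n) = \<chi> x ^ n"
  by (induction n) (simp_all add: mult_char_one mult_char_mult)

lemma mult_char_inverse: "mult_char \<chi> \<Longrightarrow> \<chi> (inverse x) = inverse (\<chi> x)"
  by (cases "x = 0")
     (simp_all add: mult_char_zero inverse_unique[symmetric] mult_char_one flip: mult_char_mult)

lemma char_pow_eq:
  assumes "mult_char \<chi>" "n > 0"
  shows "char_pow \<chi> n x = \<chi> x ^ n"
  using assms by (simp add: char_pow_def mult_char_zero)

text \<open>Replacing \<open>x\<close> by \<open>a * x\<close> multiplies the sum by
  \<open>\<chi> a ^ n\<close>, which differs from 1.\<close>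

lemma sum_mult_char_power_eq_0:
  fixes \<chi> :: "'a :: {field, finite} \<Rightarrow> complex"
  assumes "mult_char \<chi>" "a \<noteq> 0" "\<chi> a ^ n \<noteq> 1"
  shows "(\<Sum>x\<in>UNIV. \<chi> x ^ n) = 0"
proof -
  have "(\<Sum>x\<in>UNIV. \<chi> x ^ n) = (\<Sum>x\<in>UNIV. \<chi> (a * x) ^ n)"
    by (rule sum.reindex_bij_witness[of _ "\<lambda>x. a * x" "\<lambda>x. x / a"]) (use assms(2) in auto)
  also have "\<dots> = \<chi> a ^ n * (\<Sum>x\<in>UNIV. \<chi> x ^ n)"
    by (simp add: mult_char_mult[OF assms(1)] power_mult_distrib sum_distrib_left)
  finally show ?thesis
    using assms(3) by simp
qed

section \<open>Characters of order \<open>l\<close> and the number of \<open>l\<close>-th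
  roots\<close>

context
  fixes \<chi> :: "'a :: {field, finite} \<Rightarrow> complex" and l :: nat
  assumes \<chi>: "mult_char \<chi>" and order: "char_order \<chi> = l"
begin

text \<open>The least exponent in the definition of the order exists, because
  \<open>CARD('a) - 1\<close> is a positive exponent that makes \<open>\<chi>\<close>
  trivial.\<close>

lemma char_order_pos: "l > 0"
  and char_order_power_eq_one: "x \<noteq> 0 \<Longrightarrow> \<chi> x ^ l = 1"
proof -
  have "CARD('a) \<ge> card {0, 1 :: 'a}"
    by (intro card_mono) auto
  moreover have "\<chi> x ^ (CARD('a) - 1) = 1" if "x \<noteq> 0" for x
    using power_card_minus_one_eq_one[OF that] \<chi>
    by (simp add: mult_char_one flip: mult_char_power)
  ultimately have "\<exists>n. n > 0 \<and> char_pow \<chi> n = triv_char"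
    by (intro exI[of _ "CARD('a) - 1"]) (auto simp: char_pow_def triv_char_def fun_eq_iff)
  from LeastI_ex[OF this] have l: "l > 0" "char_pow \<chi> l = triv_char"
    using order by (auto simp: char_order_def)
  then show "l > 0"
    by simp
  show "x \<noteq> 0 \<Longrightarrow> \<chi> x ^ l = 1"
    using fun_cong[OF l(2), of x] by (simp add: char_pow_def triv_char_def)
qed

lemma char_order_nontrivial:
  assumes "0 < i" "i < l"
  obtains a where "a \<noteq> 0" "\<chi> a ^ i \<noteq> 1"
proof -
  have "\<not> (i > 0 \<and> char_pow \<chi> i = triv_char)"
    using assms(2) order not_less_Least[of i "\<lambda>n. n > 0 \<and> char_pow \<chi> n = triv_char"]
    by (simp add: char_order_def)
  then show ?thesis
    using assms(1) that by (force simp: char_pow_def triv_char_def fun_eq_iff split: if_splits)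
qed

lemma sum_char_power_eq_0:
  assumes "0 < i" "i < l"
  shows "(\<Sum>x\<in>UNIV. \<chi> x ^ i) = 0"
  using char_order_nontrivial[OF assms] sum_mult_char_power_eq_0[OF \<chi>] assms by (metis less_irrefl)

lemma sum_powers_char:
  assumes "x \<noteq> 0"
  shows "(\<Sum>i<l. \<chi> x ^ i) = (if \<chi> x = 1 then of_nat l else 0)"
  using char_order_power_eq_one[OF assms] geometric_sum[of "\<chi> x" l] by auto

lemma sum_powers_char_conv: "(\<Sum>i<l. \<chi> x ^ i) = 1 + (\<Sum>i=1..l-1. \<chi> x ^ i)"
proof -
  have "{..<l} = insert 0 {1..l-1}"
    using char_order_pos by auto
  then show ?thesis
    by simp
qed

text \<open>
  For nonzero \<open>z\<close> the left-hand side is at most the right-hand side, which is \<open>l\<close> or 0 according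
  to whether \<open>\<chi> z = 1\<close>.  Both sides add up to the number of nonzero field elements, so they agree.
\<close>

lemma card_power_eq_char_sum:
  "of_nat (card {y. y ^ l = z}) = 1 + (\<Sum>i=1..l-1. \<chi> z ^ i)"
proof (cases "z = 0")
  case True
  have "{y :: 'a. y ^ l = 0} = {0}"
    using char_order_pos by auto
  then show ?thesis
    using True \<chi> by (simp add: mult_char_zero sum.neutral)
next
  case False
  let ?f = "\<lambda>z. card {y :: 'a. y ^ l = z}" and ?g = "\<lambda>z. if \<chi> z = 1 then l else 0"
  \<comment> \<open>If some \<open>y\<close> satisfies \<open>y ^ l = z\<close>, then
    \<open>\<chi> z = \<chi> y ^ l = 1\<close>, and the bound on the number of roots
    applies.\<close>
  have le: "?f z \<le> ?g z" if "z \<in> UNIV - {0}" for z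
  proof (cases "{y. y ^ l = z} = {}")
    case False
    then obtain y where "y ^ l = z"
      by auto
    then have "\<chi> z = 1"
      using that char_order_power_eq_one[of y] char_order_pos \<chi> by (auto simp: mult_char_power)
    then show ?thesis
      using card_power_eq_le[OF char_order_pos] by simp
  qed simp
  \<comment> \<open>Orthogonality: the powers of \<open>\<chi>\<close> with exponent
    \<open>0 < i < l\<close> sum to 0, so only the term \<open>i = 0\<close> survives.\<close>
  have "of_nat (\<Sum>z\<in>UNIV-{0}. ?g z) = (\<Sum>z\<in>UNIV-{0}. \<Sum>i<l. \<chi> z ^ i)"
    unfolding of_nat_sum by (rule sum.cong) (simp_all add: sum_powers_char)
  also have "\<dots> = (\<Sum>z\<in>UNIV-{0}. 1 + (\<Sum>i=1..l-1. \<chi> z ^ i))"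
    by (simp only: sum_powers_char_conv)
  also have "\<dots> = of_nat (CARD('a) - 1) + (\<Sum>i=1..l-1. \<Sum>z\<in>UNIV-{0}. \<chi> z ^ i)"
    by (subst sum.swap) (simp add: sum.distrib)
  also have "(\<Sum>i=1..l-1. \<Sum>z\<in>UNIV-{0}. \<chi> z ^ i) = 0"
    by (rule sum.neutral, rule ballI)
       (use sum_char_power_eq_0 \<chi> in \<open>auto simp: sum_diff1 mult_char_zero\<close>)
  finally have g: "(\<Sum>z\<in>UNIV-{0}. ?g z) = CARD('a) - 1"
    by (simp only: add_0_right of_nat_eq_iff)
  \<comment> \<open>The fibres of the \<open>l\<close>-th power map over nonzero \<open>z\<close>
    partition the nonzero elements.\<close>
  have "(\<Sum>z\<in>UNIV-{0}. ?f z) = card (\<Union>z\<in>UNIV-{0}. {y :: 'a. y ^ l = z})"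
    by (rule card_UN_disjoint[symmetric]) auto
  also have "(\<Union>z\<in>UNIV-{0}. {y :: 'a. y ^ l = z}) = UNIV - {0 :: 'a}"
    using char_order_pos by auto
  finally have "(\<Sum>z\<in>UNIV-{0}. ?f z) = (\<Sum>z\<in>UNIV-{0}. ?g z)"
    using g by simp
  then have "?f z = ?g z"
    using le by (rule sum_mono_inv) (use False in auto)
  then show ?thesis
    using sum_powers_char[OF False] sum_powers_char_conv[of z] by (simp split: if_splits)
qed

lemma card_power_eq_graph:
  fixes f :: "'a \<Rightarrow> 'a"
  shows "of_nat (card {(u, y). y ^ l = f u}) =
    of_nat CARD('a) + (\<Sum>i=1..l-1. \<Sum>u\<in>UNIV. \<chi> (f u) ^ i)"
proof -
  have "{(u, y). y ^ l = f u} = (SIGMA u:UNIV. {y. y ^ l = f u})"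
    by auto
  then have "of_nat (card {(u, y). y ^ l = f u}) =
      (\<Sum>u\<in>UNIV. of_nat (card {y. y ^ l = f u}) :: complex)"
    by simp
  also have "\<dots> = (\<Sum>u\<in>UNIV. 1 + (\<Sum>i=1..l-1. \<chi> (f u) ^ i))"
    by (simp only: card_power_eq_char_sum)
  also have "\<dots> = of_nat CARD('a) + (\<Sum>i=1..l-1. \<Sum>u\<in>UNIV. \<chi> (f u) ^ i)"
    by (subst sum.swap) (simp add: sum.distrib)
  finally show ?thesis .
qed

section \<open>Binomial coefficients as Jacobi sums\<close>

lemma char_power_complement:
  assumes "i \<le> l" "x \<noteq> 0"
  shows "\<chi> (inverse x) ^ i = \<chi> x ^ (l - i)"
proof -
  have "\<chi> x ^ (l - i) * \<chi> x ^ i = 1"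
    using assms char_order_power_eq_one by (simp flip: power_add)
  then show ?thesis
    using \<chi> by (simp add: mult_char_inverse power_inverse inverse_unique mult.commute)
qed

text \<open>Up to sign and the factor \<open>1 / CARD('a)\<close>, the binomial coefficient is a
  Jacobi sum over \<open>A x\<close> and \<open>\<chi> (1 - x) ^ (l - i)\<close>. As
  \<open>c * (- 1) * (1 - x) = c * x - c\<close> and \<open>A\<close> ignores the factor
  \<open>c\<close>, substituting \<open>w = c * x\<close> gives the right-hand side.\<close>

lemma char_binom_rescale:
  assumes "0 < i" "i < l" "c \<noteq> 0" and A: "\<And>x. A (c * x) = A x"
  shows "of_nat CARD('a) * (char_pow \<chi> i (inverse c) * char_binom A (char_pow \<chi> i)) =
    (\<Sum>w\<in>UNIV. A w * \<chi> (w - c) ^ (l - i))"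
proof -
  \<comment> \<open>At \<open>x = 0\<close> both sides vanish: \<open>inverse 0 = 0\<close> on the
    left, \<open>l - i > 0\<close> on the right.\<close>
  have inv: "char_inv (char_pow \<chi> i) x = \<chi> x ^ (l - i)" for x
    using char_power_complement[of i x] assms(1,2) \<chi>
    by (cases "x = 0")
       (auto simp: char_inv_def char_pow_def mult_char_zero mult_char_inverse power_inverse)
  have pow: "char_pow \<chi> i (inverse x) = \<chi> x ^ (l - i)" if "x \<noteq> 0" for x
    using char_power_complement[of i x] assms(1,2) \<chi> that by (simp add: char_pow_eq)
  \<comment> \<open>Since \<open>- 1\<close> is its own inverse, the sign
    \<open>\<chi> (- 1) ^ i\<close> may be written with exponent \<open>l - i\<close> as
    well.\<close>
  have "of_nat CARD('a) * (char_pow \<chi> i (inverse c) * char_binom A (char_pow \<chi> i)) =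
      \<chi> c ^ (l - i) * (\<chi> (- 1) ^ (l - i) * (\<Sum>x\<in>UNIV. A x * \<chi> (1 - x) ^ (l - i)))"
    using pow[of "- 1"] pow[OF assms(3)] by (simp add: char_binom_def inv)
  also have "\<dots> = (\<Sum>x\<in>UNIV. A x * (\<chi> c * \<chi> (- 1) * \<chi> (1 - x)) ^ (l - i))"
    by (simp add: sum_distrib_left power_mult_distrib mult_ac)
  also have "\<dots> = (\<Sum>x\<in>UNIV. A (c * x) * \<chi> (c * x - c) ^ (l - i))"
    by (simp only: A right_diff_distrib flip: mult_char_mult[OF \<chi>]) (simp add: algebra_simps)
  also have "\<dots> = (\<Sum>w\<in>UNIV. A w * \<chi> (w - c) ^ (l - i))"
    by (rule sum.reindex_bij_witness[of _ "\<lambda>x. x / c" "\<lambda>x. c * x"]) (use assms(3) in auto)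
  finally show ?thesis .
qed

end

lemma card_power_eq_cube_minus:
  fixes \<chi> \<psi> :: "'a :: {field, finite} \<Rightarrow> complex"
  assumes \<chi>: "mult_char \<chi>" "char_order \<chi> = l"
    and \<psi>: "mult_char \<psi>" "char_order \<psi> = 3" and "d \<noteq> 0"
  shows "of_nat (card {(u, y :: 'a). y ^ l = u ^ 3 - d ^ 3}) =
    of_nat CARD('a) + of_nat CARD('a) * (\<Sum>i=1..l-1. char_pow \<chi> i (inverse (d ^ 3)) *
      (char_binom \<psi> (char_pow \<chi> i) + char_binom (char_pow \<psi> 2) (char_pow \<chi> i)))"
proof -
  \<comment> \<open>A character of order 3 is 1 on nonzero cubes; this is the invariance that
    rescaling by \<open>d ^ 3\<close> requires.\<close>
  have cube: "\<psi> (d ^ 3 * x) = \<psi> x" for x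
    using char_order_power_eq_one[OF \<psi> \<open>d \<noteq> 0\<close>] \<psi>(1) by (simp add: mult_char_mult mult_char_power)
  have sum: "(\<Sum>u\<in>UNIV. \<chi> (u ^ 3 - d ^ 3) ^ j) =
      (\<Sum>w\<in>UNIV. \<psi> w * \<chi> (w - d ^ 3) ^ j) + (\<Sum>w\<in>UNIV. char_pow \<psi> 2 w * \<chi> (w - d ^ 3) ^ j)"
    if j: "0 < j" "j < l" for j
  proof -
    \<comment> \<open>Grouping by \<open>w = u ^ 3\<close>, each \<open>w\<close> has
      \<open>1 + \<psi> w + \<psi> w ^ 2\<close> cube roots. The summand 1 yields a complete sum of
      a nontrivial character, which is 0.\<close>
    have "(\<Sum>u\<in>UNIV. \<chi> (u ^ 3 - d ^ 3) ^ j) =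
        (\<Sum>w\<in>UNIV. of_nat (card {u. u ^ 3 = w}) * \<chi> (w - d ^ 3) ^ j)"
      using sum_fun_comp[of UNIV UNIV "\<lambda>u. u ^ 3" "\<lambda>w. \<chi> (w - d ^ 3) ^ j"] by simp
    also have "\<dots> = (\<Sum>w\<in>UNIV. (1 + \<psi> w + char_pow \<psi> 2 w) * \<chi> (w - d ^ 3) ^ j)"
      using \<psi> by (simp add: card_power_eq_char_sum[OF \<psi>] char_pow_eq numeral_2_eq_2 add_ac)
    also have "\<dots> = (\<Sum>w\<in>UNIV. \<chi> (w - d ^ 3) ^ j) +
        ((\<Sum>w\<in>UNIV. \<psi> w * \<chi> (w - d ^ 3) ^ j) + (\<Sum>w\<in>UNIV. char_pow \<psi> 2 w * \<chi> (w - d ^ 3) ^ j))"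
      by (simp add: sum.distrib algebra_simps)
    also have "(\<Sum>w\<in>UNIV. \<chi> (w - d ^ 3) ^ j) = (\<Sum>w\<in>UNIV. \<chi> w ^ j)"
      by (rule sum.reindex_bij_witness[of _ "\<lambda>x. x + d ^ 3" "\<lambda>x. x - d ^ 3"]) auto
    also have "\<dots> = 0"
      using j by (rule sum_char_power_eq_0[OF \<chi>])
    finally show ?thesis
      by simp
  qed
  \<comment> \<open>The order of summation is reversed because the binomial coefficient with lower
    entry \<open>char_pow \<chi> i\<close> involves the exponent \<open>l - i\<close>.\<close>
  have "(\<Sum>i=1..l-1. \<Sum>u\<in>UNIV. \<chi> (u ^ 3 - d ^ 3) ^ i) =
      (\<Sum>i=1..l-1. \<Sum>u\<in>UNIV. \<chi> (u ^ 3 - d ^ 3) ^ (l - i))"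
    by (rule sum.reindex_bij_witness[of _ "\<lambda>i. l - i" "\<lambda>i. l - i"]) auto
  also have "\<dots> = (\<Sum>i=1..l-1. of_nat CARD('a) * (char_pow \<chi> i (inverse (d ^ 3)) *
      (char_binom \<psi> (char_pow \<chi> i) + char_binom (char_pow \<psi> 2) (char_pow \<chi> i))))"
  proof (rule sum.cong)
    fix i assume "i \<in> {1..l - 1}"
    then have i: "0 < i" "i < l" "0 < l - i" "l - i < l"
      by auto
    show "(\<Sum>u\<in>UNIV. \<chi> (u ^ 3 - d ^ 3) ^ (l - i)) =
        of_nat CARD('a) * (char_pow \<chi> i (inverse (d ^ 3)) *
          (char_binom \<psi> (char_pow \<chi> i) + char_binom (char_pow \<psi> 2) (char_pow \<chi> i)))"
      using sum[OF i(3,4)] char_binom_rescale[OF \<chi> i(1,2), of "d ^ 3" \<psi>]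
        char_binom_rescale[OF \<chi> i(1,2), of "d ^ 3" "char_pow \<psi> 2"] \<open>d \<noteq> 0\<close> \<psi>(1)
      by (simp add: cube char_pow_eq distrib_left)
  qed simp
  finally show ?thesis
    unfolding card_power_eq_graph[OF \<chi>] by (simp only: sum_distrib_left)
qed

section \<open>The curve for \<open>lam = 1/3\<close>\<close>

lemma rat_red_third: "rat_red (1 / 3) = (1 / 3 :: 'a :: field)"
  and rat_red_27_8: "rat_red (27 / 8) = (27 / 8 :: 'a :: field)"
proof -
  have gcd_27_8: "gcd 27 8 = (1 :: int)"
    by (simp add: gcd_non_0_int)
  have "quotient_of (1 / 3) = (1, 3)" "quotient_of (27 / 8) = (27, 8)"
    by (simp_all add: Fract_of_int_quotient[of 1 3, simplified, symmetric] quotient_of_Fract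
        Fract_of_int_quotient[of 27 8, simplified, symmetric] Rat.normalize_def gcd_27_8)
  then show "rat_red (1 / 3) = (1 / 3 :: 'a)" "rat_red (27 / 8) = (27 / 8 :: 'a)"
    by (simp_all add: rat_red_def)
qed

text \<open>The cubic is \<open>x^3 - x^2 + lam x - lam\<close>. For \<open>lam = 1/3\<close> the
  shift \<open>u = x - 1/3\<close> removes the quadratic and the linear term at once and leaves the
  constant \<open>-8/27\<close>.\<close>

lemma card_affine_points_third:
  assumes "(3 :: 'a :: {field, finite}) \<noteq> 0"
  shows "card (affine_points l (1 / 3) :: ('a \<times> 'a) set) =
    card {(u, y :: 'a). y ^ l = u ^ 3 - (2 / 3) ^ 3}"
proof -
  have eq: "(x - 1) * (x\<^sup>2 + 1 / 3) = (x - 1 / 3) ^ 3 - (2 / 3) ^ 3" for x :: 'a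
  proof -
    \<comment> \<open>Multiplying by 27, which is nonzero because 3 is, clears the
      denominators.\<close>
    have "27 * ((x - 1) * (x\<^sup>2 + 1 / 3)) = 9 * ((x - 1) * (3 * x\<^sup>2 + 1))"
      using assms by (simp add: field_simps)
    moreover have "27 * ((x - 1 / 3) ^ 3 - (2 / 3) ^ 3) = (3 * x - 1) ^ 3 - 8"
    proof -
      have "27 * ((x - 1 / 3) ^ 3 - (2 / 3) ^ 3) = (3 * (x - 1 / 3)) ^ 3 - (3 * (2 / 3)) ^ 3"
        unfolding power_mult_distrib by simp
      moreover have "3 * (x - 1 / 3) = 3 * x - 1" "3 * (2 / 3) = (2 :: 'a)"
        using assms by (simp_all add: right_diff_distrib)
      ultimately have "27 * ((x - 1 / 3) ^ 3 - (2 / 3) ^ 3) = (3 * x - 1) ^ 3 - 2 ^ 3"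
        by (simp only:)
      then show ?thesis
        by simp
    qed
    moreover have "9 * ((x - 1) * (3 * x\<^sup>2 + 1)) = (3 * x - 1) ^ 3 - 8"
      by algebra
    moreover have "(27 :: 'a) = 3 ^ 3"
      by simp
    then have "(27 :: 'a) \<noteq> 0"
      using assms by (metis power_not_zero)
    ultimately show ?thesis
      by (metis mult_left_cancel)
  qed
  have "bij_betw (\<lambda>(x, y). (x - 1 / 3, y)) (affine_points l (1 / 3) :: ('a \<times> 'a) set)
      {(u, y). y ^ l = u ^ 3 - (2 / 3) ^ 3}"
    by (rule bij_betw_byWitness[where f' = "\<lambda>(u, y). (u + 1 / 3, y)"])
       (auto simp: affine_points_def rat_red_third eq)
  then show ?thesis
    by (rule bij_betw_same_card)
qed

theorem theorem1p5:
  fixes p e q l :: nat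
    and S \<chi>\<^sub>3 :: "'a :: {field, finite} \<Rightarrow> complex"
    and lam :: rat
  assumes "l \<ge> 2"
    and "prime p" and "p \<notin> {2, 3}" and "e \<ge> 1" and "q = p ^ e"
    and "[q = 1] (mod l)"
    and "CARD('a) = q"
    and "mult_char S" and "char_order S = l"
    and "[q = 1] (mod 3) \<Longrightarrow> mult_char \<chi>\<^sub>3"
    and "[q = 1] (mod 3) \<Longrightarrow> char_order \<chi>\<^sub>3 = 3"
    and "lam = 1 / 3"
  shows "(l \<noteq> 3 \<and> [q = 2] (mod 3) \<longrightarrow> - curve_trace TYPE('a) l lam = 0) \<and>
    (l \<noteq> 3 \<and> [q = 1] (mod 3) \<longrightarrow>
       of_int (- curve_trace TYPE('a) l lam) =
         of_nat q * (\<Sum>i = 1..l - 1. char_pow S i (rat_red (27 / 8)) *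
           (char_binom \<chi>\<^sub>3 (char_pow S i) + char_binom (char_pow \<chi>\<^sub>3 2) (char_pow S i)))) \<and>
    (l = 3 \<longrightarrow>
       of_int (- curve_trace TYPE('a) l lam) =
         2 + of_nat q * (\<Sum>i = 1..2.
           char_binom \<chi>\<^sub>3 (char_pow \<chi>\<^sub>3 i) + char_binom (char_pow \<chi>\<^sub>3 2) (char_pow \<chi>\<^sub>3 i)))"
proof -
  have two: "(2 :: 'a) \<noteq> 0" and three: "(3 :: 'a) \<noteq> 0"
    using of_nat_prime_eq_0_imp_eq[where 'a = 'a, of p e 2]
      of_nat_prime_eq_0_imp_eq[where 'a = 'a, of p e 3] assms(2,3,5,7) by auto
  let ?N = "card {(u, y :: 'a). y ^ l = u ^ 3 - (2 / 3) ^ 3}"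
  \<comment> \<open>Here the argument \<open>27 / 8\<close> arises: the constant subtracted from
    \<open>u ^ 3\<close> is \<open>8 / 27\<close>, and its inverse enters by rescaling.\<close>
  have inv: "inverse ((2 / 3) ^ 3) = (rat_red (27 / 8) :: 'a)"
    by (simp add: rat_red_27_8 power_divide)
  have q: "CARD('a) = q" by fact
  \<comment> \<open>One point at infinity cancels the 1 in the trace; the 2 accounts for the two
    further ones.\<close>
  have trace: "- curve_trace TYPE('a) l lam =
      int ?N - int q + (if l = 3 \<and> [q = 1] (mod 3) then 2 else 0)"
    using card_affine_points_third[OF three, of l] unfolding assms(12) q
    by (simp add: q curve_trace_def curve_points_def)
  have "?N = q" if "[q = 2] (mod 3)"
  proof -
    have "bij (\<lambda>x :: 'a. x ^ 3)"
      using that bij_cube[where 'a = 'a] q by simp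
    then obtain g where g: "\<And>x :: 'a. g (x ^ 3) = x" "\<And>x. g x ^ 3 = x"
      by (metis bij_pointE)
    \<comment> \<open>With \<open>g\<close> the cube root, \<open>y\<close> determines
      \<open>u\<close>, so each \<open>y\<close> carries exactly one point.\<close>
    have bij: "bij_betw snd {(u, y :: 'a). y ^ l = u ^ 3 - (2 / 3) ^ 3} UNIV"
      by (rule bij_betw_byWitness[where f' = "\<lambda>y. (g (y ^ l + (2 / 3) ^ 3), y)"]) (auto simp: g)
    show ?thesis
      using bij_betw_same_card[OF bij] q by simp
  qed
  then have case0: "- curve_trace TYPE('a) l lam = 0" if "l \<noteq> 3" "[q = 2] (mod 3)"
    using trace that by simp
  \<comment> \<open>\<open>T\<close> is kept general: it becomes \<open>S\<close> for
    \<open>l \<noteq> 3\<close> and \<open>\<chi>\<^sub>3\<close> for \<open>l = 3\<close>.\<close>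
  have count: "of_int (int ?N - int q) = of_nat q * (\<Sum>i = 1..l - 1. char_pow T i (rat_red (27 / 8)) *
      (char_binom \<chi>\<^sub>3 (char_pow T i) + char_binom (char_pow \<chi>\<^sub>3 2) (char_pow T i)))"
    if "[q = 1] (mod 3)" "mult_char T" "char_order T = l" for T
    using card_power_eq_cube_minus[OF that(2,3) assms(10,11)[OF that(1)], of "2 / 3"] two three
    unfolding inv q by simp
  have case1: "of_int (- curve_trace TYPE('a) l lam) =
         of_nat q * (\<Sum>i = 1..l - 1. char_pow S i (rat_red (27 / 8)) *
           (char_binom \<chi>\<^sub>3 (char_pow S i) + char_binom (char_pow \<chi>\<^sub>3 2) (char_pow S i)))"
    if "l \<noteq> 3" "[q = 1] (mod 3)"
    using count[OF that(2) assms(8,9)] trace that(1) by simp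
  have case3: "of_int (- curve_trace TYPE('a) l lam) =
         2 + of_nat q * (\<Sum>i = 1..2.
           char_binom \<chi>\<^sub>3 (char_pow \<chi>\<^sub>3 i) + char_binom (char_pow \<chi>\<^sub>3 2) (char_pow \<chi>\<^sub>3 i))"
    if "l = 3"
  proof -
    have q1: "[q = 1] (mod 3)"
      using assms(6) that by simp
    note \<chi>\<^sub>3 = assms(10,11)[OF q1]
    \<comment> \<open>\<open>27 / 8\<close> is the inverse of a nonzero cube, so the character
      factor in \<open>count\<close> disappears.\<close>
    have "char_pow \<chi>\<^sub>3 i (rat_red (27 / 8)) = 1" for i
    proof -
      have "(2 / 3 :: 'a) \<noteq> 0"
        using two three by simp
      then have "\<chi>\<^sub>3 (2 / 3) ^ 3 = 1" "inverse ((2 / 3 :: 'a) ^ 3) \<noteq> 0"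
        using char_order_power_eq_one[OF \<chi>\<^sub>3] by auto
      moreover from this have "\<chi>\<^sub>3 (inverse ((2 / 3) ^ 3)) = 1"
        by (simp only: mult_char_inverse[OF \<chi>\<^sub>3(1)] mult_char_power[OF \<chi>\<^sub>3(1)] inverse_1)
      ultimately show ?thesis
        unfolding inv by (simp add: char_pow_def)
    qed
    then show ?thesis
      using count[OF q1 \<chi>\<^sub>3(1)] \<chi>\<^sub>3(2) trace q1 that by simp
  qed
  show ?thesis
    using case0 case1 case3 by blast
qed

end
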